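(* Let $\mu\in(0,1)$ and let $\mathbf p(t)=(p_0(t),p_1(t),\ldots)$ be a solution of the system of ODEs $$p_0'=-(\mu-1+p_0)\,p_0,\qquad p_n'=n\,p_{n+1}+(\mu-1+p_0)\,p_{n-1}-(n-1)\,p_n-(\mu-1+p_0)\,p_n\quad(n\ge1),$$ with $\mathbf p(0)\in\mathcal S_\mu$. Let $K>0$ be such that $K^2+2K\le\frac12$, and set $$C_\mu:=\frac{\min\{\mu,1-\mu\}}{4},\qquad \delta:=K\,\min\{\mu,1-\mu\},\qquad t^*:=\min\{s\ge0\mid p_0(s)\le 1-\mu+\delta\}.$$ Then for all $t\ge t^*$, $$G[\mathbf p(t)]-(1-\mu)\le\bigl(G[\mathbf p(t^* )]-(1-\mu)\bigr)\,e^{-\frac{2C_\mu}{3\mu}(t-t^* )}.$$ On the other hand, for all $t\ge t^*$, $$G[\mathbf p(t)]-(1-\mu)\ge\frac{\gamma_\mu}{1-\mu}\,e^{-(1-\mu)t},\qquad\text{where } \gamma_\mu:=\frac{2}{\mu}\,C_\mu\,(1-\mu)\,\frac{\mu-1+p_0(0)}{p_0(0)}.$$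
   Context: $\mathbb N=\{0,1,2,\ldots\}$. For $\mu>0$, $\mathcal S_\mu=\{\mathbf p=(p_n)_{n\ge0} \mid p_n\ge 0,\ \sum_{n\ge0}p_n=1,\ \sum_{n\ge0} n\,p_n=\mu\}$ is the set of probability distributions on $\mathbb N$ with mean $\mu$. Total mass and mean are conserved by the system, and the solution $\mathbf p(t)$ with $\mathbf p(0)\in\mathcal S_\mu$ is understood to lie in $\mathcal S_\mu$ for all $t\ge 0$. The Gini index of a probability distribution $\mathbf p$ on $\mathbb N$ with mean $\mu>0$ is $$G[\mathbf p]=\frac{1}{2\mu}\sum_{i\in\mathbb N}\sum_{j\in\mathbb N}|i-j|\,p_i\,p_j.$$ *)

theory Defs
  imports "HOL-Analysis.Analysis"
begin

definition mean :: "(nat \<Rightarrow> real) \<Rightarrow> real" where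
  "mean p = (\<Sum>n. real n * p n)"

definition distrs :: "real \<Rightarrow> (nat \<Rightarrow> real) set" where
  "distrs \<mu> = {p. (\<forall>n. 0 \<le> p n) \<and> p sums 1 \<and> (\<lambda>n. real n * p n) sums \<mu>}"

definition gini :: "(nat \<Rightarrow> real) \<Rightarrow> real" where
  "gini p = 1 / (2 * mean p) * (\<Sum>i. \<Sum>j. \<bar>real i - real j\<bar> * p i * p j)"

(* Here p t n stands for p_n(t). Time is restricted to [0, infinity), so the derivative at 0 is
   one-sided. In the second clause n - 1 is only used for n \<ge> 1, so it does not truncate. *)
definition solves_system :: "real \<Rightarrow> (real \<Rightarrow> nat \<Rightarrow> real) \<Rightarrow> bool" where
  "solves_system \<mu> p \<longleftrightarrow>
     (\<forall>t\<ge>0. ((\<lambda>s. p s 0) has_real_derivative - (\<mu> - 1 + p t 0) * p t 0) (at t within {0..})) \<and>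
     (\<forall>t\<ge>0. \<forall>n\<ge>1. ((\<lambda>s. p s n) has_real_derivative
        real n * p t (n + 1) + (\<mu> - 1 + p t 0) * p t (n - 1)
          - (real n - 1) * p t n - (\<mu> - 1 + p t 0) * p t n) (at t within {0..}))"

end

theory Submission
  imports Defs
begin

text \<open>
  Write \<open>T\<^sub>k = \<Sum>\<^bsub>i > k\<^esub> p\<^sub>i\<close> and \<open>r = \<mu> - 1 + p\<^sub>0 = \<mu> - T\<^sub>0\<close>. From
  \<open>\<bar>i - j\<bar> = i + j - 2 min i j\<close> one gets \<open>\<mu> (G - (1 - \<mu>)) = \<mu>\<^sup>2 - \<Sum>\<^sub>k T\<^sub>k\<^sup>2\<close>. Since
  \<open>\<Sum>\<^bsub>k \<ge> 1\<^esub> T\<^sub>k = r\<close>, this quantity lies between \<open>2 r (\<mu> - r)\<close> and \<open>2 \<mu> r\<close>. The system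
  gives \<open>T\<^sub>k' = r p\<^sub>k - k p\<^bsub>k+1\<^esub>\<close>, and each truncation \<open>H\<^sub>N = \<mu>\<^sup>2 - \<Sum>\<^bsub>k \<le> N\<^esub> T\<^sub>k\<^sup>2\<close> satisfies
  \<open>H\<^sub>N' \<le> - 2 r ((\<mu> - r) p\<^sub>0 - r)\<close>. Once \<open>r \<le> \<delta>\<close> the bracket is at least \<open>C\<close>, so that
  \<open>H\<^sub>N' \<le> - (C / \<mu>) H\<^sub>N\<close>, and no limit has to be interchanged with a derivative. The lower
  bound follows from \<open>(r / p\<^sub>0)' = - (1 - \<mu>) r / p\<^sub>0\<close>.
\<close>

section \<open>Tail sums of a distribution on the naturals\<close>

definition tail :: "(nat \<Rightarrow> real) \<Rightarrow> nat \<Rightarrow> real" where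
  "tail p k = 1 - (\<Sum>i\<le>k. p i)"

lemma tail_0: "tail p 0 = 1 - p 0"
  by (simp add: tail_def)

lemma tail_Suc: "tail p (Suc k) = tail p k - p (Suc k)"
  by (simp add: tail_def)

text \<open>Justifies encoding the tail as a finite complement: it is the mass above
  \<open>k\<close>, while the finite form can be differentiated term by term along the flow.\<close>

lemma tail_sums:
  assumes "p \<in> distrs \<mu>"
  shows "(\<lambda>i. p (i + Suc k)) sums tail p k"
proof -
  have "p sums 1" using assms by (simp add: distrs_def)
  then show ?thesis
    using sums_iff_shift[of p "Suc k" "tail p k"] by (simp add: tail_def lessThan_Suc_atMost)
qed

lemma tail_nonneg:
  assumes "p \<in> distrs \<mu>"
  shows "0 \<le> tail p k"
proof -
  have "\<forall>n. 0 \<le> p n" using assms by (simp add: distrs_def)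
  then show ?thesis
    using sums_le[OF _ sums_zero tail_sums[OF assms, of k]] by simp
qed

lemma tail_le_1:
  assumes "p \<in> distrs \<mu>"
  shows "tail p k \<le> 1"
  using assms by (simp add: tail_def distrs_def sum_nonneg)

text \<open>Every index above N is at least N, so N T_N is at most the remainder of the convergent
  mean series. This removes the boundary term in summation by parts.\<close>

lemma tendsto_mult_tail:
  assumes "p \<in> distrs \<mu>"
  shows "(\<lambda>N. real N * tail p N) \<longlonglongrightarrow> 0"
proof -
  have p: "\<And>n. 0 \<le> p n" and m: "(\<lambda>n. real n * p n) sums \<mu>"
    using assms by (auto simp: distrs_def)
  have le: "real N * tail p N \<le> \<mu> - (\<Sum>i\<le>N. real i * p i)" for N
  proof (rule sums_le)
    show "(\<lambda>i. real N * p (i + Suc N)) sums (real N * tail p N)"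
      by (intro sums_mult tail_sums[OF assms])
    show "(\<lambda>i. real (i + Suc N) * p (i + Suc N)) sums (\<mu> - (\<Sum>i\<le>N. real i * p i))"
      using sums_iff_shift[of "\<lambda>n. real n * p n" "Suc N"] m
      by (simp add: lessThan_Suc_atMost)
    show "real N * p (i + Suc N) \<le> real (i + Suc N) * p (i + Suc N)" for i
      using p by (intro mult_right_mono) auto
  qed
  have "(\<lambda>N. \<mu> - (\<Sum>i\<le>N. real i * p i)) \<longlonglongrightarrow> \<mu> - \<mu>"
    by (intro tendsto_diff tendsto_const) (use m in \<open>simp add: sums_def_le\<close>)
  then have lim: "(\<lambda>N. \<mu> - (\<Sum>i\<le>N. real i * p i)) \<longlonglongrightarrow> 0" by simp
  show ?thesis
  proof (rule tendsto_sandwich[OF _ _ tendsto_const lim])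
    show "\<forall>\<^sub>F N in sequentially. 0 \<le> real N * tail p N"
      using tail_nonneg[OF assms] by simp
    show "\<forall>\<^sub>F N in sequentially. real N * tail p N \<le> \<mu> - (\<Sum>i\<le>N. real i * p i)"
      by (intro always_eventually allI le)
  qed
qed

section \<open>Summation by parts against tails\<close>

lemma sum_by_parts_tail:
  "(\<Sum>i<Suc N. p i * (\<Sum>k<i. f k)) = (\<Sum>k<N. f k * tail p k) - tail p N * (\<Sum>k<N. f k)"
  by (induction N) (auto simp: tail_Suc algebra_simps)

text \<open>The partial sums differ by a boundary term between 0 and N T_N, which vanishes. The
  equivalence carries convergence both ways; it is applied to \<open>f\<close> constantly 1, to an
  indicator, and to the tail itself.\<close>

lemma sums_by_parts_tail:
  assumes p: "p \<in> distrs \<mu>" and f: "\<And>k. 0 \<le> f k" "\<And>k. f k \<le> 1"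
  shows "(\<lambda>i. p i * (\<Sum>k<i. f k)) sums s \<longleftrightarrow> (\<lambda>k. f k * tail p k) sums s"
proof -
  have lim0: "(\<lambda>N. tail p N * (\<Sum>k<N. f k)) \<longlonglongrightarrow> 0"
  proof (rule tendsto_sandwich[OF _ _ tendsto_const tendsto_mult_tail[OF p]])
    show "\<forall>\<^sub>F N in sequentially. 0 \<le> tail p N * (\<Sum>k<N. f k)"
      using f tail_nonneg[OF p] by (auto intro!: always_eventually mult_nonneg_nonneg sum_nonneg)
    have "tail p N * (\<Sum>k<N. f k) \<le> real N * tail p N" for N
      using mult_left_mono[OF sum_mono[of "{..<N}" f "\<lambda>_. 1"] tail_nonneg[OF p, of N]] f
      by (simp add: mult.commute)
    then show "\<forall>\<^sub>F N in sequentially. tail p N * (\<Sum>k<N. f k) \<le> real N * tail p N"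
      by simp
  qed
  have "(\<lambda>i. p i * (\<Sum>k<i. f k)) sums s \<longleftrightarrow>
      (\<lambda>N. \<Sum>i<Suc N. p i * (\<Sum>k<i. f k)) \<longlonglongrightarrow> s"
    unfolding sums_def
    by (rule filterlim_sequentially_Suc[of "\<lambda>N. \<Sum>i<N. p i * (\<Sum>k<i. f k)", symmetric])
  also have "\<dots> \<longleftrightarrow> (\<lambda>N. \<Sum>k<N. f k * tail p k) \<longlonglongrightarrow> s"
    unfolding sum_by_parts_tail
  proof
    assume "(\<lambda>N. (\<Sum>k<N. f k * tail p k) - tail p N * (\<Sum>k<N. f k)) \<longlonglongrightarrow> s"
    from tendsto_add[OF this lim0] show "(\<lambda>N. \<Sum>k<N. f k * tail p k) \<longlonglongrightarrow> s" by simp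
  next
    assume "(\<lambda>N. \<Sum>k<N. f k * tail p k) \<longlonglongrightarrow> s"
    from tendsto_diff[OF this lim0]
    show "(\<lambda>N. (\<Sum>k<N. f k * tail p k) - tail p N * (\<Sum>k<N. f k)) \<longlonglongrightarrow> s" by simp
  qed
  finally show ?thesis by (simp add: sums_def)
qed

lemma tail_sums_mean:
  assumes "p \<in> distrs \<mu>"
  shows "tail p sums \<mu>"
  using sums_by_parts_tail[OF assms, of "\<lambda>_. 1" \<mu>] assms
  by (simp add: distrs_def mult.commute)

text \<open>Summation by parts with the indicator of k < i, because min i j counts the k below both
  i and j.\<close>

lemma sums_min_tail:
  assumes "p \<in> distrs \<mu>"
  shows "(\<lambda>j. real (min i j) * p j) sums (\<Sum>k<i. tail p k)"
proof -
  have "(\<lambda>k. of_bool (k < i) * tail p k) sums (\<Sum>k<i. of_bool (k < i) * tail p k)"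
    by (rule sums_finite) auto
  also have "(\<Sum>k<i. of_bool (k < i) * tail p k) = (\<Sum>k<i. tail p k)"
    by (intro sum.cong) auto
  finally have "(\<lambda>j. p j * (\<Sum>k<j. of_bool (k < i))) sums (\<Sum>k<i. tail p k)"
    by (subst sums_by_parts_tail[OF assms]) auto
  moreover have "(\<Sum>k<j. of_bool (k < i)) = real (min i j)" for j
  proof -
    have "{..<j} \<inter> {k. k < i} = {..<min i j}" by auto
    then show ?thesis by simp
  qed
  ultimately show ?thesis by (simp add: mult.commute)
qed

section \<open>The Gini index through squared tails\<close>

lemma gini_inner_sums:
  assumes "p \<in> distrs \<mu>"
  shows "(\<lambda>j. \<bar>real i - real j\<bar> * p i * p j) sums
    (real i * p i + \<mu> * p i - 2 * (p i * (\<Sum>k<i. tail p k)))"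
proof -
  have p: "p sums 1" "(\<lambda>n. real n * p n) sums \<mu>"
    using assms by (auto simp: distrs_def)
  have "(\<lambda>j. p i * (real i * p j + real j * p j - 2 * (real (min i j) * p j))) sums
      (p i * (real i * 1 + \<mu> - 2 * (\<Sum>k<i. tail p k)))"
    by (intro sums_mult sums_add sums_diff p sums_min_tail[OF assms])
  moreover have "p i * (real i * p j + real j * p j - 2 * (real (min i j) * p j))
      = \<bar>real i - real j\<bar> * p i * p j" for j
    by (cases "i \<le> j") (auto simp: algebra_simps)
  ultimately show ?thesis by (simp add: algebra_simps)
qed

lemma summable_tail_power2:
  assumes "p \<in> distrs \<mu>"
  shows "summable (\<lambda>k. (tail p k)\<^sup>2)"
proof (rule summable_comparison_test')
  show "summable (tail p)" using tail_sums_mean[OF assms] by (simp add: sums_iff)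
  show "norm ((tail p k)\<^sup>2) \<le> tail p k" for k
    using tail_nonneg[OF assms, of k] tail_le_1[OF assms, of k]
    by (simp add: power2_eq_square mult_left_le)
qed

lemma gini_eq_tail:
  assumes "p \<in> distrs \<mu>" and "0 < \<mu>"
  shows "gini p = 1 - (\<Sum>k. (tail p k)\<^sup>2) / \<mu>"
proof -
  have p: "p sums 1" "(\<lambda>n. real n * p n) sums \<mu>"
    using assms by (auto simp: distrs_def)
  let ?S = "\<Sum>k. (tail p k)\<^sup>2"
  have "(\<lambda>k. tail p k * tail p k) sums ?S"
    using summable_sums[OF summable_tail_power2[OF assms(1)]] by (simp add: power2_eq_square)
  \<comment> \<open>Second use of summation by parts, now with \<open>f = tail p\<close>: the double
    sum of minima collapses to the sum of squares.\<close>
  then have "(\<lambda>i. p i * (\<Sum>k<i. tail p k)) sums ?S"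
    by (subst sums_by_parts_tail[OF assms(1)])
      (auto simp: tail_nonneg[OF assms(1)] tail_le_1[OF assms(1)])
  then have "(\<lambda>i. real i * p i + \<mu> * p i - 2 * (p i * (\<Sum>k<i. tail p k))) sums (\<mu> + \<mu> * 1 - 2 * ?S)"
    by (intro sums_mult sums_add sums_diff p)
  then have "(\<Sum>i. \<Sum>j. \<bar>real i - real j\<bar> * p i * p j) = 2 * \<mu> - 2 * ?S"
    using gini_inner_sums[OF assms(1)] by (simp add: sums_iff)
  moreover have "mean p = \<mu>" using p by (simp add: mean_def sums_iff)
  ultimately show ?thesis using assms(2) by (simp add: gini_def field_simps)
qed

section \<open>Estimates by the excess r\<close>

lemma tail_Suc_sums:
  assumes "p \<in> distrs \<mu>"
  shows "(\<lambda>k. tail p (Suc k)) sums (\<mu> - 1 + p 0)"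
  using sums_iff_shift[of "tail p" 1 "\<mu> - 1 + p 0"] tail_sums_mean[OF assms]
  by (simp add: tail_0 algebra_simps)

lemma tail_Suc_le:
  assumes "p \<in> distrs \<mu>"
  shows "tail p (Suc k) \<le> \<mu> - 1 + p 0"
  using sum_le_suminf[of "\<lambda>k. tail p (Suc k)" "{k}"] tail_Suc_sums[OF assms]
    tail_nonneg[OF assms] by (simp add: sums_iff)

lemma excess_nonneg:
  assumes "p \<in> distrs \<mu>"
  shows "0 \<le> \<mu> - 1 + p 0"
  using tail_Suc_le[OF assms, of 0] tail_nonneg[OF assms, of 1] by simp

text \<open>The full series is the mean minus the mass outside 0, which is exactly r. It bounds the
  total loss term in the derivative uniformly in \<open>N\<close>.\<close>

lemma sum_mult_Suc_le:
  assumes "p \<in> distrs \<mu>"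
  shows "(\<Sum>k\<le>N. real k * p (Suc k)) \<le> \<mu> - 1 + p 0"
proof -
  have p: "\<And>n. 0 \<le> p n" "p sums 1" "(\<lambda>n. real n * p n) sums \<mu>"
    using assms by (auto simp: distrs_def)
  have "(\<lambda>k. real (Suc k) * p (Suc k)) sums \<mu>"
    using p(3) sums_Suc_iff[of "\<lambda>n. real n * p n" \<mu>] by simp
  moreover have "(\<lambda>k. p (Suc k)) sums (1 - p 0)"
    using p(2) sums_Suc_iff[of p "1 - p 0"] by simp
  ultimately have "(\<lambda>k. real (Suc k) * p (Suc k) - p (Suc k)) sums (\<mu> - (1 - p 0))"
    by (rule sums_diff)
  then have "(\<lambda>k. real k * p (Suc k)) sums (\<mu> - 1 + p 0)"
    by (simp add: algebra_simps)
  then show ?thesis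
    using sum_le_suminf[of "\<lambda>k. real k * p (Suc k)" "{..N}"] p by (simp add: sums_iff)
qed

text \<open>Here T_0 = \<mu> - r, and each later tail is at most their sum r, so their squares add
  up to at most r * r. What remains is \<mu>^2 - (\<mu> - r)^2 - r^2 = 2 r (\<mu> - r).\<close>

lemma gini_excess_lower:
  assumes p: "p \<in> distrs \<mu>"
  shows "2 * (\<mu> - 1 + p 0) * (1 - p 0) \<le> \<mu>\<^sup>2 - (\<Sum>k. (tail p k)\<^sup>2)"
proof -
  let ?r = "\<mu> - 1 + p 0"
  have "summable (\<lambda>k. (tail p k)\<^sup>2)" by (rule summable_tail_power2[OF p])
  then have split: "(\<Sum>k. (tail p k)\<^sup>2) = (1 - p 0)\<^sup>2 + (\<Sum>k. (tail p (Suc k))\<^sup>2)"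
    and summ: "summable (\<lambda>k. (tail p (Suc k))\<^sup>2)"
    using suminf_split_head[of "\<lambda>k. (tail p k)\<^sup>2"]
      summable_Suc_iff[of "\<lambda>k. (tail p k)\<^sup>2"] by (auto simp: tail_0)
  have "(\<Sum>k. (tail p (Suc k))\<^sup>2) \<le> ?r * ?r"
  proof (rule sums_le[OF _ summable_sums[OF summ] sums_mult[OF tail_Suc_sums[OF p]]])
    show "(tail p (Suc k))\<^sup>2 \<le> ?r * tail p (Suc k)" for k
      using tail_Suc_le[OF p] tail_nonneg[OF p] by (simp add: power2_eq_square mult_right_mono)
  qed
  then show ?thesis unfolding split by (simp add: power2_eq_square algebra_simps)
qed

section \<open>Differentiation along the system\<close>

lemma has_real_derivative_tail:
  assumes "solves_system \<mu> p" and "0 \<le> t"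
  shows "((\<lambda>s. tail (p s) k) has_real_derivative
    (\<mu> - 1 + p t 0) * p t k - real k * p t (Suc k)) (at t within {0..})"
proof (induction k)
  case 0
  have "((\<lambda>s. p s 0) has_real_derivative - (\<mu> - 1 + p t 0) * p t 0) (at t within {0..})"
    using assms by (simp add: solves_system_def)
  from DERIV_diff[OF DERIV_const[of 1] this] show ?case
    unfolding tail_0 by (simp add: algebra_simps)
next
  case (Suc k)
  have "((\<lambda>s. p s (Suc k)) has_real_derivative
        real (Suc k) * p t (Suc k + 1) + (\<mu> - 1 + p t 0) * p t (Suc k - 1)
          - (real (Suc k) - 1) * p t (Suc k) - (\<mu> - 1 + p t 0) * p t (Suc k)) (at t within {0..})"
    using assms unfolding solves_system_def by (metis One_nat_def le_add1 plus_1_eq_Suc)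
  \<comment> \<open>The terms r p_k and k p_(k+1) of T_k' recur in p_(k+1)' and cancel, leaving only
    the net flux between k+1 and k+2.\<close>
  from DERIV_diff[OF Suc this] show ?case
    unfolding tail_Suc by (simp add: algebra_simps)
qed

text \<open>Bridges one-sided and two-sided derivatives: inside the open interval they agree, and at
  the endpoints only continuity enters.\<close>

lemma has_real_derivative_nonpos_imp_le:
  fixes f f' :: "real \<Rightarrow> real"
  assumes "\<And>x. a \<le> x \<Longrightarrow> (f has_real_derivative f' x) (at x within {a..})"
    and "\<And>x. s \<le> x \<Longrightarrow> f' x \<le> 0" and "a \<le> s" "s \<le> t"
  shows "f t \<le> f s"
proof (rule DERIV_nonpos_imp_decreasing_open[OF \<open>s \<le> t\<close>])
  show "continuous_on {s..t} f"
  proof (rule continuous_on_subset)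
    show "continuous_on {a..} f"
      unfolding continuous_on_eq_continuous_within using DERIV_continuous[OF assms(1)] by simp
  qed (use \<open>a \<le> s\<close> in auto)
  show "\<exists>y. (f has_real_derivative y) (at x) \<and> y \<le> 0" if "s < x" "x < t" for x
  proof -
    have "at x within {a..} = at x"
      using that \<open>a \<le> s\<close> by (intro at_within_interior) auto
    then show ?thesis using assms(1)[of x] assms(2)[of x] that \<open>a \<le> s\<close> by auto
  qed
qed

text \<open>Source of the condition on \<open>K\<close> and of the constant C = m / 4. Since p_0 = 1
  - \<mu> + r, the claim reads r + C \<le> (\<mu> - r) p_0. With r = x m, each case writes the gap
  as m times a sum of two terms, nonnegative by m \<le> 1/2 and x^2 + 2 x \<le> 1/2.\<close>

lemma quadratic_margin:
  fixes \<mu> K r m :: real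
  assumes "0 < \<mu>" "\<mu> < 1" "K\<^sup>2 + 2 * K \<le> 1 / 2" "m = min \<mu> (1 - \<mu>)" "0 \<le> r" "r \<le> K * m"
  shows "r + m / 4 \<le> (\<mu> - r) * (1 - \<mu> + r)"
proof -
  have m: "0 < m" "m \<le> 1 / 2" using assms(1,2,4) by (auto simp: min_def)
  define x where "x = r / m"
  have r: "r = x * m" using m by (simp add: x_def)
  have x: "0 \<le> x" "x \<le> K" using assms m by (auto simp: x_def field_simps)
  have "x\<^sup>2 \<le> K\<^sup>2" using x by (intro power_mono) auto
  then have x2: "x\<^sup>2 + 2 * x \<le> 1 / 2" using x assms(3) by linarith
  show ?thesis
  proof (cases "\<mu> \<le> 1 / 2")
    case True
    then have "\<mu> = m" using assms by auto
    then have "(\<mu> - r) * (1 - \<mu> + r) - (r + m / 4)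
        = m * ((1 / 2 - m) * (1 - x)\<^sup>2 + (1 / 2 - (x\<^sup>2 + 2 * x)) / 2)"
      by (simp add: r power2_eq_square field_simps)
    also have "0 \<le> \<dots>" using m x2 by (intro mult_nonneg_nonneg add_nonneg_nonneg) auto
    finally show ?thesis by simp
  next
    case False
    then have \<mu>: "\<mu> = 1 - m" using assms by auto
    then have "(\<mu> - r) * (1 - \<mu> + r) - (r + m / 4)
        = m * ((1 / 2 - m) * (1 + x)\<^sup>2 + (1 / 2 - (x\<^sup>2 + 2 * x)) / 2)"
      by (simp add: r \<mu> power2_eq_square field_simps)
    also have "0 \<le> \<dots>" using m x2 by (intro mult_nonneg_nonneg add_nonneg_nonneg) auto
    finally show ?thesis by simp
  qed
qed

text \<open>The equation for p_0 is closed and logistic. As p_0 - r = 1 - \<mu> is constant, r / p_0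
  solves a linear equation, and its product with the integrating factor has derivative 0.\<close>

lemma excess_ratio:
  assumes sol: "solves_system \<mu> p" and pos: "\<And>t. 0 \<le> t \<Longrightarrow> 0 < p t 0" and "0 \<le> t"
  shows "(\<mu> - 1 + p t 0) / p t 0 = (\<mu> - 1 + p 0 0) / p 0 0 * exp (- (1 - \<mu>) * t)"
proof -
  define f where "f t = (\<mu> - 1 + p t 0) / p t 0 * exp ((1 - \<mu>) * t)" for t
  have "(f has_real_derivative 0) (at x within {0..})" if "x \<in> {0..}" for x
  proof -
    have "((\<lambda>s. p s 0) has_real_derivative - (\<mu> - 1 + p x 0) * p x 0) (at x within {0..})"
      using sol that by (simp add: solves_system_def)
    then show ?thesis
      unfolding f_def using pos[of x] that
      by (auto intro!: derivative_eq_intros simp: field_simps)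
  qed
  then obtain c where "\<forall>x\<in>{0..}. f x = c"
    using has_field_derivative_zero_constant[of "{0..}" f] by auto
  then have "f t = f 0" using \<open>0 \<le> t\<close> by simp
  then have "(\<mu> - 1 + p t 0) / p t 0 * (exp ((1 - \<mu>) * t) * exp (- (1 - \<mu>) * t))
      = (\<mu> - 1 + p 0 0) / p 0 0 * exp (- (1 - \<mu>) * t)"
    by (simp add: f_def mult.assoc[symmetric])
  moreover have "exp ((1 - \<mu>) * t) * exp (- (1 - \<mu>) * t) = 1"
    unfolding exp_add[symmetric] by (simp add: algebra_simps)
  ultimately show ?thesis by simp
qed

text \<open>The term k = 0 equals 2 r (\<mu> - r) p_0. For k \<ge> 1 the gain is dropped as
  nonnegative and T_k \<le> r is used in the loss; all losses together cost at most 2 r * r.\<close>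

lemma deriv_sum_tail_power2_ge:
  assumes p: "p \<in> distrs \<mu>"
  defines "r \<equiv> \<mu> - 1 + p 0"
  shows "2 * r * ((\<mu> - r) * p 0 - r)
    \<le> (\<Sum>k\<le>N. 2 * tail p k * (r * p k - real k * p (Suc k)))"
proof -
  have r: "0 \<le> r" using excess_nonneg[OF p] by (simp add: r_def)
  have nn: "\<And>n. 0 \<le> p n" using p by (simp add: distrs_def)
  \<comment> \<open>Written as a sum supported at k = 0, so that the comparison can be made term by
    term.\<close>
  have "2 * r * ((\<mu> - r) * p 0) = (\<Sum>k\<le>N. if k = 0 then 2 * r * ((\<mu> - r) * p 0) else 0)"
    by simp
  moreover have "(\<Sum>k\<le>N. 2 * r * (real k * p (Suc k))) \<le> 2 * r * r"
    using sum_mult_Suc_le[OF p, of N] r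
    by (simp add: sum_distrib_left[symmetric] r_def mult_left_mono)
  moreover have "(\<Sum>k\<le>N. if k = 0 then 2 * r * ((\<mu> - r) * p 0) else 0)
      - (\<Sum>k\<le>N. 2 * r * (real k * p (Suc k)))
      \<le> (\<Sum>k\<le>N. 2 * tail p k * (r * p k - real k * p (Suc k)))"
    unfolding sum_subtractf[symmetric]
  proof (rule sum_mono)
    fix k
    show "(if k = 0 then 2 * r * ((\<mu> - r) * p 0) else 0) - 2 * r * (real k * p (Suc k))
        \<le> 2 * tail p k * (r * p k - real k * p (Suc k))"
    proof (cases k)
      case 0
      then show ?thesis by (simp add: tail_0 r_def algebra_simps)
    next
      case (Suc j)
      have "tail p k \<le> r" using tail_Suc_le[OF p] by (simp add: Suc r_def)
      then have "tail p k * (real k * p (Suc k)) \<le> r * (real k * p (Suc k))"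
        using nn by (intro mult_right_mono) auto
      moreover have "0 \<le> tail p k * (r * p k)"
        using tail_nonneg[OF p] r nn by simp
      moreover have "2 * tail p k * (r * p k - real k * p (Suc k))
          = 2 * (tail p k * (r * p k)) - 2 * (tail p k * (real k * p (Suc k)))"
        by (simp add: right_diff_distrib)
      moreover have "k \<noteq> 0" using Suc by simp
      ultimately show ?thesis by (simp only: if_False)
    qed
  qed
  ultimately show ?thesis by (simp add: right_diff_distrib)
qed

section \<open>The hitting time and the two exponential bounds\<close>

theorem theorem2:
  fixes \<mu> K C \<delta> tstar \<gamma> :: real and p :: "real \<Rightarrow> nat \<Rightarrow> real"
  assumes "0 < \<mu>" and "\<mu> < 1"
    and "solves_system \<mu> p"
    and "p 0 \<in> distrs \<mu>"
    and "\<And>t. 0 \<le> t \<Longrightarrow> p t \<in> distrs \<mu>"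
    and "0 < K" and "K\<^sup>2 + 2 * K \<le> 1 / 2"
    and "C = min \<mu> (1 - \<mu>) / 4"
    and "\<delta> = K * min \<mu> (1 - \<mu>)"
    and "tstar = (LEAST s. 0 \<le> s \<and> p s 0 \<le> 1 - \<mu> + \<delta>)"
    and "\<gamma> = 2 / \<mu> * C * (1 - \<mu>) * ((\<mu> - 1 + p 0 0) / p 0 0)"
  shows "(\<forall>t\<ge>tstar. gini (p t) - (1 - \<mu>)
              \<le> (gini (p tstar) - (1 - \<mu>)) * exp (- (2 * C / (3 * \<mu>)) * (t - tstar)))
       \<and> (\<forall>t\<ge>tstar. gini (p t) - (1 - \<mu>)
              \<ge> \<gamma> / (1 - \<mu>) * exp (- (1 - \<mu>) * t))"
proof -
  note sol = assms(3) and distr = assms(5)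
  define r where "r t = \<mu> - 1 + p t 0" for t
  have r_nonneg: "0 \<le> r t" if "0 \<le> t" for t
    using excess_nonneg[OF distr[OF that]] by (simp add: r_def)
  have p0_pos: "0 < p t 0" if "0 \<le> t" for t
    using r_nonneg[OF that] assms(2) by (simp add: r_def)
  have p0_le_1: "p t 0 \<le> 1" if "0 \<le> t" for t
    using tail_nonneg[OF distr[OF that], of 0] by (simp add: tail_0)
  have p0_deriv: "((\<lambda>s. p s 0) has_real_derivative - r t * p t 0) (at t within {0..})"
    if "0 \<le> t" for t
    using sol that by (simp add: solves_system_def r_def)
  have ratio: "r t / p t 0 = r 0 / p 0 0 * exp (- (1 - \<mu>) * t)" if "0 \<le> t" for t
    using excess_ratio[OF sol p0_pos that] by (simp add: r_def)
  have mono: "p t 0 \<le> p s 0" if "0 \<le> s" "s \<le> t" for s t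
  proof (rule has_real_derivative_nonpos_imp_le[OF p0_deriv _ that])
    fix x assume "s \<le> x"
    then have "0 \<le> r x" "0 < p x 0" using r_nonneg p0_pos that by auto
    then show "- r x * p x 0 \<le> 0" by simp
  qed
  have "0 < \<delta>" "0 < C" using assms by auto
  \<comment> \<open>\<open>LEAST\<close> over the reals is meaningful only if the minimum is
    attained. \<open>A\<close> is closed, nonempty and bounded below, so \<open>Inf A\<close> is
    that minimum.\<close>
  define A where "A = {0..} \<inter> (\<lambda>s. p s 0) -` {..1 - \<mu> + \<delta>}"
  have "tstar \<in> A"
  proof -
    have "continuous_on {0..} (\<lambda>s. p s 0)"
      using p0_deriv by (auto simp: continuous_on_eq_continuous_within intro!: DERIV_continuous)
    then have "closed A"
      unfolding A_def by (intro continuous_closed_preimage) auto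
    moreover have "A \<noteq> {}"
    proof -
      \<comment> \<open>Solves exp (- (1 - \<mu>) s) = \<delta>, cut off at time 0. Since p_0 \<le>
        1 and r(0) \<le> p_0(0), this gives r(s) \<le> r(s) / p_0(s) \<le> \<delta>.\<close>
      define s where "s = max 0 (- ln \<delta> / (1 - \<mu>))"
      have s: "0 \<le> s" "- (1 - \<mu>) * s \<le> ln \<delta>"
        using assms(2) by (auto simp: s_def field_simps max_def)
      have "r s = r s / p s 0 * p s 0" using p0_pos[OF s(1)] by simp
      also have "\<dots> \<le> r s / p s 0 * 1"
        using p0_le_1[OF s(1)] r_nonneg[OF s(1)] p0_pos[OF s(1)] by (intro mult_left_mono) auto
      also have "\<dots> \<le> 1 * exp (- (1 - \<mu>) * s)"
        unfolding mult_1_right ratio[OF s(1)] using p0_pos[of 0] assms(2)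
        by (intro mult_right_mono) (auto simp: r_def field_simps)
      also have "\<dots> \<le> \<delta>"
        using s(2) \<open>0 < \<delta>\<close> by (metis exp_le_cancel_iff exp_ln mult_1)
      finally have "s \<in> A" using s(1) by (simp add: A_def r_def)
      then show ?thesis by auto
    qed
    moreover have bdd: "bdd_below A" by (auto simp: A_def intro: bdd_belowI)
    ultimately have "Inf A \<in> A" by (intro closed_contains_Inf)
    moreover have "tstar = Inf A"
      unfolding assms(10)
      by (rule Least_equality) (use \<open>Inf A \<in> A\<close> cInf_lower[OF _ bdd] in \<open>auto simp: A_def\<close>)
    ultimately show ?thesis by simp
  qed
  then have tstar: "0 \<le> tstar" "p tstar 0 \<le> 1 - \<mu> + \<delta>" by (auto simp: A_def)
  \<comment> \<open>As p_0 decreases, r \<le> \<delta> persists after \<open>tstar\<close>.\<close>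
  have margin: "r t + C \<le> (\<mu> - r t) * p t 0" if "tstar \<le> t" for t
    using quadratic_margin[OF assms(1,2,7) refl, of "r t"] r_nonneg[of t]
      mono[OF tstar(1) that] tstar that
    by (simp add: assms(8,9) r_def)
  have gini: "gini (p t) - (1 - \<mu>) = (\<mu>\<^sup>2 - (\<Sum>k. (tail (p t) k)\<^sup>2)) / \<mu>" if "0 \<le> t" for t
    using gini_eq_tail[OF distr[OF that] assms(1)] assms(1)
    by (simp add: field_simps power2_eq_square)

  \<comment> \<open>Decay of the Gini excess\<close>
  define c where "c = 2 * C / (3 * \<mu>)"
  have "gini (p t) - (1 - \<mu>) \<le> (gini (p tstar) - (1 - \<mu>)) * exp (- c * (t - tstar))"
    if "tstar \<le> t" for t
  proof -
    define H where "H N s = \<mu>\<^sup>2 - (\<Sum>k\<le>N. (tail (p s) k)\<^sup>2)" for N s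
    have "H N t \<le> H N tstar * exp (- c * (t - tstar))" for N
    proof -
      define H' where
        "H' s = - (\<Sum>k\<le>N. 2 * tail (p s) k * (r s * p s k - real k * p s (Suc k)))" for s
      have H': "(H N has_real_derivative H' s) (at s within {0..})" if "0 \<le> s" for s
      proof -
        have "((\<lambda>s. (tail (p s) k)\<^sup>2) has_real_derivative
            2 * tail (p s) k * (r s * p s k - real k * p s (Suc k))) (at s within {0..})" for k
          unfolding power2_eq_square r_def
          by (rule DERIV_cong[OF DERIV_mult[OF has_real_derivative_tail[OF sol that]
                has_real_derivative_tail[OF sol that]]]) simp
        then have "((\<lambda>s. \<Sum>k\<le>N. (tail (p s) k)\<^sup>2) has_real_derivative
            (\<Sum>k\<le>N. 2 * tail (p s) k * (r s * p s k - real k * p s (Suc k)))) (at s within {0..})"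
          by (rule DERIV_sum)
        from DERIV_diff[OF DERIV_const[of "\<mu>\<^sup>2"] this] show ?thesis
          by (simp add: H_def[abs_def] H'_def)
      qed
      have decay: "H' s + c * H N s \<le> 0" if "tstar \<le> s" for s
      proof -
        have s: "0 \<le> s" using that tstar by simp
        have "H' s \<le> - (2 * r s * ((\<mu> - r s) * p s 0 - r s))"
          using deriv_sum_tail_power2_ge[OF distr[OF s], of N] by (simp add: H'_def r_def)
        moreover have "2 * r s * C \<le> 2 * r s * ((\<mu> - r s) * p s 0 - r s)"
          using margin[OF that] r_nonneg[OF s] by (intro mult_left_mono) auto
        moreover have "c * H N s \<le> 2 * r s * C"
        proof -
          \<comment> \<open>Keeping only T_0 = \<mu> - r bounds H_N by 2 \<mu> r; relaxing this to 3
            \<mu> r cancels the denominator of \<open>c\<close>.\<close>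
          have "(tail (p s) 0)\<^sup>2 \<le> (\<Sum>k\<le>N. (tail (p s) k)\<^sup>2)"
            by (rule member_le_sum) auto
          then have "H N s \<le> 2 * \<mu> * r s - (r s)\<^sup>2"
            by (simp add: H_def tail_0 r_def power2_eq_square algebra_simps)
          moreover have "0 \<le> \<mu> * r s" using r_nonneg[OF s] assms(1) by simp
          ultimately have "H N s \<le> 3 * \<mu> * r s"
            using zero_le_power2[of "r s"] by linarith
          then have "c * H N s \<le> c * (3 * \<mu> * r s)"
            using \<open>0 < C\<close> assms(1) by (intro mult_left_mono) (auto simp: c_def)
          then show ?thesis using assms(1) by (simp add: c_def mult_ac)
        qed
        ultimately show ?thesis by linarith
      qed
      \<comment> \<open>Gronwall argument with integrating factor exp (c s).\<close>
      have "H N t * exp (c * t) \<le> H N tstar * exp (c * tstar)"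
      proof (rule has_real_derivative_nonpos_imp_le[OF _ _ tstar(1) that])
        show "((\<lambda>s. H N s * exp (c * s)) has_real_derivative (H' s + c * H N s) * exp (c * s))
            (at s within {0..})" if "0 \<le> s" for s
          by (auto intro!: derivative_eq_intros H'[OF that] simp: algebra_simps)
        show "(H' s + c * H N s) * exp (c * s) \<le> 0" if "tstar \<le> s" for s
          using decay[OF that] by (simp add: mult_le_0_iff)
      qed
      then have "H N t * exp (c * t) * exp (- c * t) \<le> H N tstar * exp (c * tstar) * exp (- c * t)"
        by (rule mult_right_mono) simp
      then show ?thesis
        by (simp add: mult.assoc exp_add[symmetric] algebra_simps)
    qed
    moreover have "(\<lambda>N. H N s) \<longlonglongrightarrow> \<mu>\<^sup>2 - (\<Sum>k. (tail (p s) k)\<^sup>2)" if "0 \<le> s" for s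
      unfolding H_def using summable_sums[OF summable_tail_power2[OF distr[OF that]]]
      by (intro tendsto_diff tendsto_const) (simp add: sums_def_le)
    \<comment> \<open>\<open>c\<close> is the same for every \<open>N\<close>, so the limit is taken
      only at the two times \<open>t\<close> and \<open>tstar\<close>.\<close>
    ultimately have "\<mu>\<^sup>2 - (\<Sum>k. (tail (p t) k)\<^sup>2)
        \<le> (\<mu>\<^sup>2 - (\<Sum>k. (tail (p tstar) k)\<^sup>2)) * exp (- c * (t - tstar))"
      using that tstar(1)
      by (intro LIMSEQ_le[of "\<lambda>N. H N t" _ "\<lambda>N. H N tstar * exp (- c * (t - tstar))"]
          tendsto_mult tendsto_const) auto
    then show ?thesis
      using that tstar(1) assms(1) by (simp add: gini divide_right_mono)
  qed

  \<comment> \<open>Lower bound through the explicit ratio\<close>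
  moreover have "\<gamma> / (1 - \<mu>) * exp (- (1 - \<mu>) * t) \<le> gini (p t) - (1 - \<mu>)"
    if "tstar \<le> t" for t
  proof -
    have t: "0 \<le> t" using that tstar by simp
    have "\<gamma> / (1 - \<mu>) * exp (- (1 - \<mu>) * t) = 2 / \<mu> * C * (r 0 / p 0 0 * exp (- (1 - \<mu>) * t))"
      using assms(2) by (simp add: assms(11) r_def)
    also have "\<dots> = (2 * r t / p t 0 * C) / \<mu>"
      unfolding ratio[OF t, symmetric] by (simp add: mult_ac)
    \<comment> \<open>\<open>margin\<close> with r \<ge> 0 gives C \<le> (\<mu> - r) p_0, so p_0
      cancels and \<mu> - r = 1 - p_0 is left.\<close>
    also have "\<dots> \<le> (2 * r t / p t 0 * ((\<mu> - r t) * p t 0)) / \<mu>"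
      using margin[OF that] r_nonneg[OF t] p0_pos[OF t] assms(1)
      by (intro divide_right_mono mult_left_mono) auto
    also have "\<dots> = 2 * r t * (1 - p t 0) / \<mu>"
      using p0_pos[OF t] by (simp add: r_def)
    also have "\<dots> \<le> gini (p t) - (1 - \<mu>)"
      unfolding gini[OF t] using gini_excess_lower[OF distr[OF t]] assms(1)
      by (intro divide_right_mono) (auto simp: r_def)
    finally show ?thesis .
  qed
  ultimately show ?thesis by (simp add: c_def)
qed

end
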